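(* Let Assumption 2 (stated in the context) hold and let $\epsilon>0$. Let $\mathcal{C}_r\subseteq\mathcal{S}_r$ be compact. Assume that for all $(x,u)\in\mathcal{C}_r$, if $b(u)=0$ and $h_r(x,u)=0$, then $\nabla b(u)$ and $\frac{\partial h_r}{\partial u}(x,u)^\top$ are linearly independent. Then there exist $\alpha_0,\gamma_0$ such that, for all $\alpha>\alpha_0$ and $\gamma>\gamma_0$, the quadratic program (SGF) satisfies CRCQ at every $(x,u)\in\mathcal{C}_r$.
   Context: Conventions: for differentiable $g:\mathbb{R}^n\to\mathbb{R}^k$, $\frac{\partial g}{\partial x}\in\mathbb{R}^{k\times n}$ (so partial derivatives of scalar functions are row vectors); for scalar $g$, $\nabla g=(\frac{\partial g}{\partial x})^\top$. Plant: $\dot\xi=f(\xi,\upsilon)$ with $f:\mathbb{R}^n\times\mathbb{R}^m\to\mathbb{R}^n$. Assumption 1 (used to define $w$): for every constant input $\upsilon\equiv u$ the system has a unique globally exponentially stable equilibrium; it is denoted $w(u)$, giving a map $w:\mathbb{R}^m\to\mathbb{R}^n$ with $f(w(u),u)=0$. Data: $\Phi,h:\mathbb{R}^n\to\mathbb{R}$, $b:\mathbb{R}^m\to\mathbb{R}$. Fix $\beta>0$ and set $h_0(x,u)=h(x)$, $h_i(x,u)=\frac{\partial h_{i-1}}{\partial x}(x,u)f(x,u)+\beta h_{i-1}(x,u)$ for $i\ge1$. Let $\mathcal{S}=\{(x,u): h(x)\ge0,\ b(u)\ge0\}$ and $\mathcal{S}_i=\{(x,u): b(u)\ge0,\ h_i(x,u)\ge0\}$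 for $i\ge0$, so $\mathcal{S}_0=\mathcal{S}$. Assumption 2: (1) there is an integer $r\ge1$ such that $f$ is $(r+1)$-times and $h$ is $(r+2)$-times continuously differentiable; $\mathcal{S}_r\ne\emptyset$; $\frac{\partial h_r}{\partial u}(x,u)\ne0$ for all $(x,u)\in\mathcal{S}_r$ with $h_r(x,u)=0$; and $\frac{\partial h_i}{\partial u}(x,u)=0$ for all $(x,u)\in\mathcal{S}_r$ and all $i<r$. (2) $b$ is twice continuously differentiable, and $b(u)=0$ implies $\nabla b(u)\neq0$ for all $(x,u)\in\mathcal{S}$. (3) $\Phi$ and $w$ are twice continuously differentiable. This fixes $r$. Quadratic program (SGF), with parameters $\epsilon,\alpha,\gamma>0$: for given $(x,u)$, minimize over $q\in\mathbb{R}^m$ the function $\frac12\|q+\epsilon\frac{\partial w}{\partial u}(u)^\top\nabla\Phi(x)\|^2$ subject to (c1) $\nabla b(u)^\top q+\alpha b(u)\ge0$ and (c2) $\frac{\partial h_r}{\partial x}(x,u)f(x,u)+\frac{\partial h_r}{\partial u}(x,u)q+\gamma h_r(x,u)\ge0$. When feasible, its unique minimizer is $g_{\epsilon,\alpha,\gamma}(x,u)$. CRCQ (Constant Rank Constraint Qualification) for (SGF) at $(x,u)$: for every subset $\tilde J$ of the constraints among (c1), (c2) that are active (hold with equality) at $q=g_{\epsilon,\alpha,\gamma}(x,u)$, the family of the corresponding gradients with respect to $q$, namely $\nabla b(u')$ for (c1) and $\frac{\partial h_r}{\partial u}(x',u')^\top$ for (c2), has constant rank for $(x',u')$ in a neighborhood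 of $(x,u)$.
   Formalization: The formal theorem additionally assumes that the safe set S is nonempty; if S is empty, the condition that b(u)=0 implies ∇b(u)≠0 on S is void and the claim fails, e.g. f=u−x, β=1, h=−1−x², b=u², r=1, C_r={(2,0)}. *)

theory Defs
  imports "HOL-Analysis.Analysis"
begin

text \<open>\<open>k\<close>-times continuous differentiability on the whole space. The derivative is iterated through
  directional derivatives because the type of the \<open>k\<close>-th Frechet derivative depends on \<open>k\<close>; in
  finite dimension this is the usual notion.\<close>

primrec Ck :: "nat \<Rightarrow> ('a::euclidean_space \<Rightarrow> 'b::euclidean_space) \<Rightarrow> bool" where
  "Ck 0 g \<longleftrightarrow> continuous_on UNIV g"
| "Ck (Suc k) g \<longleftrightarrow> (\<forall>x. g differentiable (at x)) \<and>
     (\<forall>v. Ck k (\<lambda>x. frechet_derivative g (at x) v))"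

definition grad :: "(real ^ 'n \<Rightarrow> real) \<Rightarrow> real ^ 'n \<Rightarrow> real ^ 'n" where
  "grad g x = (\<chi> i. frechet_derivative g (at x) (axis i 1))"

definition jac :: "(real ^ 'm \<Rightarrow> real ^ 'n) \<Rightarrow> real ^ 'm \<Rightarrow> real ^ 'm ^ 'n" where
  "jac g u = matrix (frechet_derivative g (at u))"

text \<open>The row vector \<open>\<partial>g/\<partial>x\<close> of a scalar \<open>g\<close> is represented by its transpose, so that its product
  with a column vector becomes an inner product.\<close>

definition grad_x :: "((real ^ 'n) \<times> (real ^ 'm) \<Rightarrow> real) \<Rightarrow> (real ^ 'n) \<times> (real ^ 'm) \<Rightarrow> real ^ 'n" where
  "grad_x g = (\<lambda>(x, u). grad (\<lambda>x'. g (x', u)) x)"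

definition grad_u :: "((real ^ 'n) \<times> (real ^ 'm) \<Rightarrow> real) \<Rightarrow> (real ^ 'n) \<times> (real ^ 'm) \<Rightarrow> real ^ 'm" where
  "grad_u g = (\<lambda>(x, u). grad (\<lambda>u'. g (x, u')) u)"

definition forward_solution :: "(real ^ 'n \<Rightarrow> real ^ 'n) \<Rightarrow> (real \<Rightarrow> real ^ 'n) \<Rightarrow> bool" where
  "forward_solution F \<xi> \<longleftrightarrow>
     (\<forall>t\<ge>0. (\<xi> has_vector_derivative F (\<xi> t)) (at t within {0..}))"

definition glob_exp_stable_equilibrium :: "(real ^ 'n \<Rightarrow> real ^ 'n) \<Rightarrow> real ^ 'n \<Rightarrow> bool" where
  "glob_exp_stable_equilibrium F z \<longleftrightarrow>
     F z = 0 \<and>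
     (\<forall>x0. \<exists>\<xi>. \<xi> 0 = x0 \<and> forward_solution F \<xi>) \<and>
     (\<exists>M>0. \<exists>\<mu>>0. \<forall>\<xi>. forward_solution F \<xi> \<longrightarrow>
        (\<forall>t\<ge>0. norm (\<xi> t - z) \<le> M * exp (- \<mu> * t) * norm (\<xi> 0 - z)))"

definition steady_state_map ::
  "((real ^ 'n) \<times> (real ^ 'm) \<Rightarrow> real ^ 'n) \<Rightarrow> (real ^ 'm \<Rightarrow> real ^ 'n) \<Rightarrow> bool" where
  "steady_state_map f w \<longleftrightarrow>
     (\<forall>u. glob_exp_stable_equilibrium (\<lambda>x. f (x, u)) (w u) \<and>
          (\<forall>z. glob_exp_stable_equilibrium (\<lambda>x. f (x, u)) z \<longrightarrow> z = w u))"

primrec hseq ::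
  "((real ^ 'n) \<times> (real ^ 'm) \<Rightarrow> real ^ 'n) \<Rightarrow> (real ^ 'n \<Rightarrow> real) \<Rightarrow> real \<Rightarrow> nat
    \<Rightarrow> (real ^ 'n) \<times> (real ^ 'm) \<Rightarrow> real" where
  "hseq f h \<beta> 0 = (\<lambda>(x, u). h x)"
| "hseq f h \<beta> (Suc i) =
     (\<lambda>(x, u). grad_x (hseq f h \<beta> i) (x, u) \<bullet> f (x, u) + \<beta> * hseq f h \<beta> i (x, u))"

text \<open>The set \<open>Sset f h b \<beta> 0\<close> is the safe set \<open>{(x, u). h x \<ge> 0 \<and> b u \<ge> 0}\<close>. If it is empty, which can
  happen with \<open>Sset f h b \<beta> r\<close> nonempty, then regularity of \<open>b\<close> required on it only is void; this is why
  the theorem assumes it to be nonempty.\<close>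

definition Sset ::
  "((real ^ 'n) \<times> (real ^ 'm) \<Rightarrow> real ^ 'n) \<Rightarrow> (real ^ 'n \<Rightarrow> real) \<Rightarrow> (real ^ 'm \<Rightarrow> real) \<Rightarrow> real \<Rightarrow> nat
    \<Rightarrow> ((real ^ 'n) \<times> (real ^ 'm)) set" where
  "Sset f h b \<beta> i = {(x, u). b u \<ge> 0 \<and> hseq f h \<beta> i (x, u) \<ge> 0}"

datatype constr = C1 | C2

text \<open>The constraints read \<open>constr_val \<dots> j (x, u) q \<ge> 0\<close>.\<close>

fun constr_val ::
  "((real ^ 'n) \<times> (real ^ 'm) \<Rightarrow> real ^ 'n) \<Rightarrow> (real ^ 'n \<Rightarrow> real) \<Rightarrow> (real ^ 'm \<Rightarrow> real) \<Rightarrow> real \<Rightarrow> nat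
    \<Rightarrow> real \<Rightarrow> real \<Rightarrow> constr \<Rightarrow> (real ^ 'n) \<times> (real ^ 'm) \<Rightarrow> real ^ 'm \<Rightarrow> real" where
  "constr_val f h b \<beta> r \<alpha> \<gamma> C1 (x, u) q = grad b u \<bullet> q + \<alpha> * b u"
| "constr_val f h b \<beta> r \<alpha> \<gamma> C2 (x, u) q =
     grad_x (hseq f h \<beta> r) (x, u) \<bullet> f (x, u) + grad_u (hseq f h \<beta> r) (x, u) \<bullet> q
       + \<gamma> * hseq f h \<beta> r (x, u)"

fun constr_grad ::
  "((real ^ 'n) \<times> (real ^ 'm) \<Rightarrow> real ^ 'n) \<Rightarrow> (real ^ 'n \<Rightarrow> real) \<Rightarrow> (real ^ 'm \<Rightarrow> real) \<Rightarrow> real \<Rightarrow> nat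
    \<Rightarrow> constr \<Rightarrow> (real ^ 'n) \<times> (real ^ 'm) \<Rightarrow> real ^ 'm" where
  "constr_grad f h b \<beta> r C1 (x, u) = grad b u"
| "constr_grad f h b \<beta> r C2 (x, u) = grad_u (hseq f h \<beta> r) (x, u)"

definition sgf_cost ::
  "(real ^ 'n \<Rightarrow> real) \<Rightarrow> (real ^ 'm \<Rightarrow> real ^ 'n) \<Rightarrow> real
    \<Rightarrow> (real ^ 'n) \<times> (real ^ 'm) \<Rightarrow> real ^ 'm \<Rightarrow> real" where
  "sgf_cost \<Phi> w \<epsilon> = (\<lambda>(x, u) q.
     1 / 2 * (norm (q + \<epsilon> *\<^sub>R (transpose (jac w u) *v grad \<Phi> x)))\<^sup>2)"

definition sgf_feasible ::
  "((real ^ 'n) \<times> (real ^ 'm) \<Rightarrow> real ^ 'n) \<Rightarrow> (real ^ 'n \<Rightarrow> real) \<Rightarrow> (real ^ 'm \<Rightarrow> real) \<Rightarrow> real \<Rightarrow> nat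
    \<Rightarrow> real \<Rightarrow> real \<Rightarrow> (real ^ 'n) \<times> (real ^ 'm) \<Rightarrow> real ^ 'm \<Rightarrow> bool" where
  "sgf_feasible f h b \<beta> r \<alpha> \<gamma> p q \<longleftrightarrow> (\<forall>j. constr_val f h b \<beta> r \<alpha> \<gamma> j p q \<ge> 0)"

definition sgf_minimizer ::
  "((real ^ 'n) \<times> (real ^ 'm) \<Rightarrow> real ^ 'n) \<Rightarrow> (real ^ 'n \<Rightarrow> real) \<Rightarrow> (real ^ 'm \<Rightarrow> real) \<Rightarrow> real \<Rightarrow> nat
    \<Rightarrow> (real ^ 'n \<Rightarrow> real) \<Rightarrow> (real ^ 'm \<Rightarrow> real ^ 'n) \<Rightarrow> real \<Rightarrow> real \<Rightarrow> real
    \<Rightarrow> (real ^ 'n) \<times> (real ^ 'm) \<Rightarrow> real ^ 'm" where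
  "sgf_minimizer f h b \<beta> r \<Phi> w \<epsilon> \<alpha> \<gamma> p =
     (THE q. is_arg_min (sgf_cost \<Phi> w \<epsilon> p) (sgf_feasible f h b \<beta> r \<alpha> \<gamma> p) q)"

text \<open>CRCQ speaks about the minimizer, hence includes feasibility of the program. The rank of a
  family of vectors is the dimension of the span of its range.\<close>

definition CRCQ ::
  "((real ^ 'n) \<times> (real ^ 'm) \<Rightarrow> real ^ 'n) \<Rightarrow> (real ^ 'n \<Rightarrow> real) \<Rightarrow> (real ^ 'm \<Rightarrow> real) \<Rightarrow> real \<Rightarrow> nat
    \<Rightarrow> (real ^ 'n \<Rightarrow> real) \<Rightarrow> (real ^ 'm \<Rightarrow> real ^ 'n) \<Rightarrow> real \<Rightarrow> real \<Rightarrow> real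
    \<Rightarrow> (real ^ 'n) \<times> (real ^ 'm) \<Rightarrow> bool" where
  "CRCQ f h b \<beta> r \<Phi> w \<epsilon> \<alpha> \<gamma> p \<longleftrightarrow>
     (\<exists>q. sgf_feasible f h b \<beta> r \<alpha> \<gamma> p q) \<and>
     (\<forall>J \<subseteq> {j. constr_val f h b \<beta> r \<alpha> \<gamma> j p (sgf_minimizer f h b \<beta> r \<Phi> w \<epsilon> \<alpha> \<gamma> p) = 0}.
        \<exists>U k. open U \<and> p \<in> U \<and>
          (\<forall>p'\<in>U. dim ((\<lambda>j. constr_grad f h b \<beta> r j p') ` J) = k))"

end

theory Submission
  imports Defs
begin

text \<open>The theorem holds because, for large \<open>\<alpha>\<close> and \<open>\<gamma>\<close>, the minimizer satisfies more than constant rank: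
  the gradients of all active constraints are linearly independent. Since the cost is half the
  squared distance to a target depending continuously on \<open>p = (x, u)\<close>, the minimizer is the projection
  of that target on a polyhedron. Both constraints have the form \<open>A\<^sub>j(p) \<bullet> q + l\<^sub>j(p) + \<tau>\<^sub>j c\<^sub>j(p) \<ge> 0\<close> with
  a nonnegative margin \<open>c\<^sub>j\<close> (namely \<open>b\<close>, respectively \<open>h\<^sub>r\<close>) and a weight \<open>\<tau>\<^sub>j\<close> (\<open>\<alpha>\<close>, respectively \<open>\<gamma>\<close>).

  Fix \<open>p\<close> in \<open>C\<close>. The hypotheses say that the gradients of the constraints whose margin vanishes at
  \<open>p\<close> are independent. These constraints can therefore be satisfied strictly, uniformly near \<open>p\<close>
  and for all weights, by a fixed point; this confines the projection to a ball independent
  of the weights, on which large weights make the other constraints inactive. So only constraints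
  with independent gradients can be active, which is \<open>licq_projection_locally\<close>. Compactness of \<open>C\<close> turns the
  local thresholds for the weights into a global one (\<open>locally_uniform_threshold_compact\<close>), and
  independence persists under perturbation (\<open>eventually_independent_family\<close>), so that every subfamily
  has locally constant rank (\<open>projection_licq_imp_CRCQ\<close>).

  In particular gradients that are parallel at a point where some margin is positive do no harm,
  although their rank may jump: for large weights the two constraints are then never active together near this point.

  The continuity of all data is extracted from the smoothness assumptions by checking that \<open>h\<^sub>r\<close> is
  still twice continuously differentiable (\<open>Ck_hseq\<close>).\<close>

section \<open>Calculus of \<open>k\<close>-times continuously differentiable functions\<close>

lemma Ck_SucI:
  assumes "\<And>x. (g has_derivative G x) (at x)" and "\<And>v. Ck k (\<lambda>x. G x v)"
  shows "Ck (Suc k) g"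
proof -
  have "frechet_derivative g (at x) = G x" for x
    using frechet_derivative_at[OF assms(1)[of x]] by simp
  then show ?thesis
    using assms by (auto simp: differentiable_def)
qed

lemma Ck_has_derivative:
  "Ck (Suc k) g \<Longrightarrow> (g has_derivative frechet_derivative g (at x)) (at x)"
  by (simp add: frechet_derivative_works)

lemma Ck_SucD: "Ck (Suc k) g \<Longrightarrow> Ck k g"
proof (induction k arbitrary: g)
  case 0
  then show ?case
    by (auto intro!: continuous_at_imp_continuous_on differentiable_imp_continuous_within)
next
  case (Suc k)
  have "Ck k (\<lambda>x. frechet_derivative g (at x) v)" for v
    by (rule Suc.IH) (use Suc.prems in simp)
  with Suc.prems show ?case by simp
qed

lemma Ck_antimono: "m \<le> k \<Longrightarrow> Ck k g \<Longrightarrow> Ck m g"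
  by (induction rule: dec_induct) (auto dest: Ck_SucD simp del: Ck.simps)

lemma Ck_imp_continuous_on: "Ck k g \<Longrightarrow> continuous_on UNIV g"
  using Ck_antimono[of 0 k g] by simp

lemma Ck_const: "Ck k (\<lambda>x. c)"
proof (induction k arbitrary: c)
  case (Suc k)
  show ?case by (rule Ck_SucI[where G = "\<lambda>x v. 0"]) (auto intro: Suc)
qed simp

lemma Ck_add: "Ck k g \<Longrightarrow> Ck k g' \<Longrightarrow> Ck k (\<lambda>x. g x + g' x)"
proof (induction k arbitrary: g g')
  case 0
  then show ?case by (auto intro: continuous_intros)
next
  case (Suc k)
  note d = Ck_has_derivative[OF Suc.prems(1)] Ck_has_derivative[OF Suc.prems(2)]
  show ?case
    by (rule Ck_SucI, rule has_derivative_add[OF d]) (use Suc in auto)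
qed

lemma Ck_sum:
  assumes "\<And>i. i \<in> I \<Longrightarrow> Ck k (g i)"
  shows "Ck k (\<lambda>x. \<Sum>i\<in>I. g i x)"
  using assms by (induction I rule: infinite_finite_induct) (auto intro: Ck_add Ck_const)

lemma Ck_mult:
  fixes g g' :: "'a::euclidean_space \<Rightarrow> real"
  shows "Ck k g \<Longrightarrow> Ck k g' \<Longrightarrow> Ck k (\<lambda>x. g x * g' x)"
proof (induction k arbitrary: g g')
  case 0
  then show ?case by (auto intro: continuous_intros)
next
  case (Suc k)
  note d = Ck_has_derivative[OF Suc.prems(1)] Ck_has_derivative[OF Suc.prems(2)]
  note c = Suc.prems[THEN Ck_SucD]
  show ?case
    by (rule Ck_SucI, rule has_derivative_mult[OF d], intro Ck_add Suc.IH)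
      (use Suc.prems c in auto)
qed

lemma Ck_bounded_linear:
  assumes "bounded_linear F"
  shows "Ck k g \<Longrightarrow> Ck k (\<lambda>x. F (g x))"
proof (induction k arbitrary: g)
  case 0
  then show ?case by (auto intro: bounded_linear.continuous_on[OF assms])
next
  case (Suc k)
  show ?case
    by (rule Ck_SucI, rule bounded_linear.has_derivative[OF assms Ck_has_derivative[OF Suc.prems]])
      (use Suc in auto)
qed

lemma Ck_compose_linear:
  assumes "bounded_linear F"
  shows "Ck k g \<Longrightarrow> Ck k (\<lambda>x. g (F x))"
proof (induction k arbitrary: g)
  case 0
  then show ?case
    using continuous_on_compose2[of UNIV g UNIV F] linear_continuous_on[OF assms] by auto
next
  case (Suc k)
  show ?case
  proof (rule Ck_SucI)
    show "((\<lambda>x. g (F x)) has_derivative (\<lambda>v. frechet_derivative g (at (F x)) (F v))) (at x)" for x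
      by (rule has_derivative_compose[OF bounded_linear_imp_has_derivative[OF assms]
            Ck_has_derivative[OF Suc.prems]])
    show "Ck k (\<lambda>x. frechet_derivative g (at (F x)) (F v))" for v
      using Suc.IH[of "\<lambda>x. frechet_derivative g (at x) (F v)"] Suc.prems by simp
  qed
qed

section \<open>Partial gradients and smoothness of the iterated functions\<close>

lemma grad_x_component:
  assumes "Ck (Suc k) g"
  shows "grad_x g p $ i = frechet_derivative g (at p) (axis i 1, 0)"
proof (cases p)
  case (Pair x u)
  have "((\<lambda>x'. (x', u)) has_derivative (\<lambda>v. (v, 0))) (at x)"
    by (auto intro!: derivative_eq_intros)
  from has_derivative_compose[OF this Ck_has_derivative[OF assms]]
  have "((\<lambda>x'. g (x', u)) has_derivative (\<lambda>v. frechet_derivative g (at (x, u)) (v, 0))) (at x)" .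
  from frechet_derivative_at[OF this, symmetric] show ?thesis
    by (simp add: Pair grad_x_def grad_def)
qed

lemma grad_u_component:
  assumes "Ck (Suc k) g"
  shows "grad_u g p $ i = frechet_derivative g (at p) (0, axis i 1)"
proof (cases p)
  case (Pair x u)
  have "((\<lambda>u'. (x, u')) has_derivative (\<lambda>v. (0, v))) (at u)"
    by (auto intro!: derivative_eq_intros)
  from has_derivative_compose[OF this Ck_has_derivative[OF assms]]
  have "((\<lambda>u'. g (x, u')) has_derivative (\<lambda>v. frechet_derivative g (at (x, u)) (0, v))) (at u)" .
  from frechet_derivative_at[OF this, symmetric] show ?thesis
    by (simp add: Pair grad_u_def grad_def)
qed

lemma continuous_on_vec_componentI:
  fixes g :: "'a::topological_space \<Rightarrow> 'b::topological_space ^ 'n"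
  assumes "\<And>i. continuous_on S (\<lambda>x. g x $ i)"
  shows "continuous_on S g"
  using continuous_on_vec_lambda[of S "\<lambda>i x. g x $ i"] assms by simp

lemma continuous_on_frechet_derivative:
  "Ck (Suc k) g \<Longrightarrow> continuous_on UNIV (\<lambda>x. frechet_derivative g (at x) v)"
  using Ck_imp_continuous_on[of k "\<lambda>x. frechet_derivative g (at x) v"] by simp

lemma continuous_on_grad_x: "Ck (Suc k) g \<Longrightarrow> continuous_on UNIV (grad_x g)"
  by (intro continuous_on_vec_componentI)
    (simp add: grad_x_component continuous_on_frechet_derivative del: Ck.simps)

lemma continuous_on_grad_u: "Ck (Suc k) g \<Longrightarrow> continuous_on UNIV (grad_u g)"
  by (intro continuous_on_vec_componentI)
    (simp add: grad_u_component continuous_on_frechet_derivative del: Ck.simps)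

lemma continuous_on_grad: "Ck (Suc k) g \<Longrightarrow> continuous_on UNIV (grad g)"
  by (intro continuous_on_vec_componentI)
    (simp add: grad_def continuous_on_frechet_derivative del: Ck.simps)

text \<open>Each step of the recursion spends one derivative of \<open>h\<close>, since it differentiates the previous
  function once.\<close>

lemma Ck_hseq:
  assumes f: "Ck (r + 1) f" and h: "Ck (r + 2) h"
  shows "i \<le> r \<Longrightarrow> Ck (r + 2 - i) (hseq f h \<beta> i)"
proof (induction i)
  case 0
  then show ?case
    using Ck_compose_linear[OF bounded_linear_fst h] by (simp add: case_prod_beta' del: Ck.simps)
next
  case (Suc i)
  define k where "k = r + 1 - i"
  have prev: "Ck (Suc k) (hseq f h \<beta> i)"
    using Suc by (simp add: k_def Suc_diff_le del: Ck.simps)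
  have f': "Ck k f" by (rule Ck_antimono[OF _ f]) (simp add: k_def)
  have eq: "hseq f h \<beta> (Suc i) = (\<lambda>p. (\<Sum>j\<in>UNIV. frechet_derivative (hseq f h \<beta> i) (at p) (axis j 1, 0)
      * f p $ j) + \<beta> * hseq f h \<beta> i p)"
    by (simp add: fun_eq_iff inner_vec_def grad_x_component[OF prev])
  have "Ck k (hseq f h \<beta> (Suc i))"
    unfolding eq using prev Ck_SucD[OF prev] Ck_bounded_linear[OF bounded_linear_vec_nth f']
    by (intro Ck_add Ck_sum Ck_mult Ck_const) auto
  then show ?case using Suc.prems by (simp add: k_def del: hseq.simps Ck.simps)
qed

section \<open>Linearly independent families of vectors\<close>

lemma independent_family_prescribed_inner:
  fixes A :: "'j \<Rightarrow> 'q::euclidean_space"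
  assumes "inj_on A Z" "independent (A ` Z)"
  obtains q where "\<And>j. j \<in> Z \<Longrightarrow> A j \<bullet> q = s j"
proof -
  obtain g where g: "linear g" and gA: "\<forall>v\<in>A ` Z. g v = s (the_inv_into Z A v)"
    using linear_independent_extend[OF assms(2), of "\<lambda>v. s (the_inv_into Z A v)"] by blast
  have "A j \<bullet> adjoint g 1 = s j" if "j \<in> Z" for j
  proof -
    have "A j \<bullet> adjoint g 1 = g (A j)" using adjoint_works[OF g, of "A j" 1] by simp
    also have "\<dots> = s j" using gA that the_inv_into_f_f[OF assms(1) that] by auto
    finally show ?thesis .
  qed
  then show thesis by (rule that)
qed

text \<open>The matrix of inner products with the vectors \<open>Q k\<close> is strictly diagonally dominant, so the
  coefficient of largest modulus in a vanishing linear combination must be zero. In contrast to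
  linear independence itself, this criterion is visibly stable under perturbation of \<open>A\<close>.\<close>

lemma diagonally_dominant_imp_independent:
  fixes A Q :: "'j \<Rightarrow> 'q::euclidean_space"
  assumes fin: "finite Z"
    and dom: "\<And>k. k \<in> Z \<Longrightarrow> (\<Sum>j\<in>Z - {k}. \<bar>A j \<bullet> Q k\<bar>) < A k \<bullet> Q k"
  shows "inj_on A Z \<and> independent (A ` Z)"
proof
  show inj: "inj_on A Z"
  proof (rule inj_onI, rule ccontr)
    fix i k assume *: "i \<in> Z" "k \<in> Z" "A i = A k" "i \<noteq> k"
    have "\<bar>A i \<bullet> Q k\<bar> \<le> (\<Sum>j\<in>Z - {k}. \<bar>A j \<bullet> Q k\<bar>)"
      using * fin by (intro member_le_sum) auto
    with dom[of k] * show False by simp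
  qed
  show "independent (A ` Z)"
  proof
    assume "dependent (A ` Z)"
    then obtain x v where "v \<in> A ` Z" "x v \<noteq> 0" and "(\<Sum>v\<in>A ` Z. x v *\<^sub>R v) = 0"
      using fin by (auto simp: dependent_finite)
    then obtain i where i: "i \<in> Z" "x (A i) \<noteq> 0" and "(\<Sum>j\<in>Z. x (A j) *\<^sub>R A j) = 0"
      by (auto simp: sum.reindex[OF inj])
    define y where "y j = x (A j)" for j
    have y: "(\<Sum>j\<in>Z. y j *\<^sub>R A j) = 0" "y i \<noteq> 0"
      using \<open>(\<Sum>j\<in>Z. x (A j) *\<^sub>R A j) = 0\<close> i by (simp_all add: y_def)
    define m where "m = Max ((\<lambda>j. \<bar>y j\<bar>) ` Z)"
    have "m \<in> (\<lambda>j. \<bar>y j\<bar>) ` Z"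
      unfolding m_def using fin i by (intro Max_in) auto
    then obtain k where k: "k \<in> Z" "\<bar>y k\<bar> = m" by auto
    have le: "\<bar>y j\<bar> \<le> \<bar>y k\<bar>" if "j \<in> Z" for j
      using fin that by (simp add: k m_def)
    have "y k \<noteq> 0" using le[OF i(1)] y(2) by auto
    have "0 = (\<Sum>j\<in>Z. y j *\<^sub>R A j) \<bullet> Q k" by (simp add: y)
    also have "\<dots> = y k * (A k \<bullet> Q k) + (\<Sum>j\<in>Z - {k}. y j * (A j \<bullet> Q k))"
      using fin k by (simp add: sum.remove[of _ k] inner_add_left inner_sum_left)
    finally have "\<bar>y k\<bar> * \<bar>A k \<bullet> Q k\<bar> = \<bar>\<Sum>j\<in>Z - {k}. y j * (A j \<bullet> Q k)\<bar>"
      by (simp flip: abs_mult)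
    also have "\<dots> \<le> (\<Sum>j\<in>Z - {k}. \<bar>y k\<bar> * \<bar>A j \<bullet> Q k\<bar>)"
      by (rule order_trans[OF sum_abs]) (auto simp: abs_mult intro!: sum_mono mult_right_mono le)
    also have "\<dots> < \<bar>y k\<bar> * \<bar>A k \<bullet> Q k\<bar>"
      using dom[OF k(1)] \<open>y k \<noteq> 0\<close> by (simp flip: sum_distrib_left)
    finally show False by simp
  qed
qed

lemma eventually_nhds_less:
  fixes g g' :: "'p::topological_space \<Rightarrow> real"
  assumes "continuous_on UNIV g" "continuous_on UNIV g'" "g p < g' p"
  shows "\<forall>\<^sub>F p' in nhds p. g p' < g' p'"
  using eventually_nhds_in_open[OF open_Collect_less[OF assms(1,2)], of p] assms(3) by simp

lemma eventually_independent_family: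
  fixes A :: "'j \<Rightarrow> 'p::topological_space \<Rightarrow> 'q::euclidean_space"
  assumes fin: "finite Z"
    and cont: "\<And>j. j \<in> Z \<Longrightarrow> continuous_on UNIV (A j)"
    and indep: "inj_on (\<lambda>j. A j p) Z" "independent ((\<lambda>j. A j p) ` Z)"
  shows "\<forall>\<^sub>F p' in nhds p. inj_on (\<lambda>j. A j p') Z \<and> independent ((\<lambda>j. A j p') ` Z)"
proof -
  have "\<exists>q. \<forall>j\<in>Z. A j p \<bullet> q = (if j = k then 1 else 0)" for k
    by (rule independent_family_prescribed_inner[OF indep, of "\<lambda>j. if j = k then 1 else 0"]) blast
  then obtain Q where Q: "\<And>k j. j \<in> Z \<Longrightarrow> A j p \<bullet> Q k = (if j = k then 1 else 0)" by metis
  have "\<forall>\<^sub>F p' in nhds p. \<forall>k\<in>Z. (\<Sum>j\<in>Z - {k}. \<bar>A j p' \<bullet> Q k\<bar>) < A k p' \<bullet> Q k"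
    using fin Q by (intro eventually_ball_finite ballI eventually_nhds_less continuous_intros cont) auto
  then show ?thesis
    by (rule eventually_mono) (rule diagonally_dominant_imp_independent[OF fin], blast)
qed

section \<open>Projection onto a parametrised polyhedron\<close>

text \<open>The qualification is stated for every projection of \<open>z\<close> on the feasible set, which spares any
  appeal to uniqueness.\<close>

definition projection_licq ::
  "'j set \<Rightarrow> ('j \<Rightarrow> 'q::euclidean_space) \<Rightarrow> ('j \<Rightarrow> 'q \<Rightarrow> real) \<Rightarrow> 'q \<Rightarrow> bool" where
  "projection_licq I a val z \<longleftrightarrow>
     (\<exists>q. \<forall>j\<in>I. 0 \<le> val j q) \<and>
     (\<forall>q. (\<forall>j\<in>I. 0 \<le> val j q) \<longrightarrow>
        (\<forall>q'. (\<forall>j\<in>I. 0 \<le> val j q') \<longrightarrow> dist z q \<le> dist z q') \<longrightarrow>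
        inj_on a {j \<in> I. val j q = 0} \<and> independent (a ` {j \<in> I. val j q = 0}))"

text \<open>The index set \<open>Z\<close> of the margins vanishing at \<open>p\<close> decides everything. Independence of its
  gradients yields one fixed point \<open>q1\<close> that satisfies all constraints in \<open>Z\<close> strictly near \<open>p\<close>,
  whatever the weights. The projection of \<open>z\<close> on the feasible set cannot be farther from \<open>z\<close> than
  \<open>q1\<close>, so it stays in a ball whose radius does not depend on the weights; large weights keep
  the constraints outside \<open>Z\<close> strictly satisfied on this ball.\<close>

lemma licq_projection_locally:
  fixes A :: "'j \<Rightarrow> 'p::topological_space \<Rightarrow> 'q::euclidean_space"
    and l c :: "'j \<Rightarrow> 'p \<Rightarrow> real" and z :: "'p \<Rightarrow> 'q"
    and I :: "'j set"
  defines "val \<equiv> \<lambda>\<tau> p j q. A j p \<bullet> q + l j p + \<tau> j * c j p"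
  assumes fin: "finite I"
    and contA: "\<And>j. j \<in> I \<Longrightarrow> continuous_on UNIV (A j)"
    and contl: "\<And>j. j \<in> I \<Longrightarrow> continuous_on UNIV (l j)"
    and contc: "\<And>j. j \<in> I \<Longrightarrow> continuous_on UNIV (c j)"
    and contz: "continuous_on UNIV z"
    and nonneg: "\<And>j. j \<in> I \<Longrightarrow> 0 \<le> c j p"
    and indep: "inj_on (\<lambda>j. A j p) {j \<in> I. c j p = 0}"
      "independent ((\<lambda>j. A j p) ` {j \<in> I. c j p = 0})"
  shows "\<exists>N>0. \<forall>\<^sub>F p' in nhds p. (\<forall>j\<in>I. 0 \<le> c j p') \<longrightarrow> (\<forall>\<tau>. (\<forall>j\<in>I. N < \<tau> j) \<longrightarrow>
    projection_licq I (\<lambda>j. A j p') (val \<tau> p') (z p'))"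
proof -
  define Z where "Z = {j \<in> I. c j p = 0}"
  have Z: "finite Z" "Z \<subseteq> I" using fin by (auto simp: Z_def)
  obtain q1 where "\<And>j. j \<in> Z \<Longrightarrow> A j p \<bullet> q1 = 1 - l j p"
    using independent_family_prescribed_inner[OF indep, of "\<lambda>j. 1 - l j p"] by (auto simp: Z_def)
  then have "\<forall>\<^sub>F p' in nhds p. \<forall>j\<in>Z. 0 < A j p' \<bullet> q1 + l j p'"
    using Z by (intro eventually_ball_finite ballI eventually_nhds_less continuous_intros contA contl) auto
  note near1 = this
  have "\<forall>\<^sub>F p' in nhds p. inj_on (\<lambda>j. A j p') Z \<and> independent ((\<lambda>j. A j p') ` Z)"
    using Z indep by (intro eventually_independent_family contA) (auto simp: Z_def)
  note near2 = this
  \<comment> \<open>Triangle inequality: \<open>norm q \<le> norm z + dist z q \<le> norm z + dist z q1\<close>.\<close>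
  define R where "R p' = norm q1 + 2 * norm (z p')" for p'
  define K where "K j p' = norm (A j p') * R p' + \<bar>l j p'\<bar>" for j p'
  have pos: "0 < c j p" if "j \<in> I - Z" for j
    using nonneg[of j] that by (auto simp: Z_def order_less_le)
  have "\<forall>\<^sub>F N in at_top. 0 < N \<and> (\<forall>j\<in>I - Z. K j p / c j p < N)"
    using fin by (intro eventually_conj eventually_ball_finite eventually_gt_at_top ballI) auto
  then obtain N where N: "0 < N" and NK: "\<And>j. j \<in> I - Z \<Longrightarrow> K j p / c j p < N"
    by (auto dest!: eventually_happens simp: trivial_limit_at_top_linorder)
  have "\<forall>\<^sub>F p' in nhds p. \<forall>j\<in>I - Z. K j p' < N * c j p'"
  proof (intro eventually_ball_finite ballI)
    fix j assume j: "j \<in> I - Z"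
    show "\<forall>\<^sub>F p' in nhds p. K j p' < N * c j p'"
      unfolding K_def R_def
    proof (intro eventually_nhds_less continuous_intros contA contl contc contz)
      show "norm (A j p) * (norm q1 + 2 * norm (z p)) + \<bar>l j p\<bar> < N * c j p"
        using NK[OF j] pos[OF j] by (simp add: K_def R_def divide_less_eq)
    qed (use j in auto)
  qed (use fin in auto)
  then have "\<forall>\<^sub>F p' in nhds p. (\<forall>j\<in>I. 0 \<le> c j p') \<longrightarrow> (\<forall>\<tau>. (\<forall>j\<in>I. N < \<tau> j) \<longrightarrow>
    projection_licq I (\<lambda>j. A j p') (val \<tau> p') (z p'))"
    using near1 near2
  proof (eventually_elim, intro impI allI)
    fix p' \<tau>
    assume far: "\<forall>j\<in>I - Z. K j p' < N * c j p'"
      and q1: "\<forall>j\<in>Z. 0 < A j p' \<bullet> q1 + l j p'"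
      and ind: "inj_on (\<lambda>j. A j p') Z \<and> independent ((\<lambda>j. A j p') ` Z)"
      and c: "\<forall>j\<in>I. 0 \<le> c j p'" and \<tau>: "\<forall>j\<in>I. N < \<tau> j"
    have slack: "0 < val \<tau> p' j q" if "norm q \<le> R p'" "j \<in> I - Z" for q j
    proof -
      have "\<bar>A j p' \<bullet> q\<bar> \<le> norm (A j p') * R p'"
        using Cauchy_Schwarz_ineq2[of "A j p'" q] mult_left_mono[OF that(1), of "norm (A j p')"] by simp
      moreover have "N * c j p' \<le> \<tau> j * c j p'"
        using that c \<tau> by (intro mult_right_mono) (auto simp: less_imp_le)
      moreover have "norm (A j p') * R p' + \<bar>l j p'\<bar> < N * c j p'"
        using far that(2) by (simp add: K_def)
      ultimately show ?thesis unfolding val_def by linarith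
    qed
    have "0 \<le> val \<tau> p' j q1" if "j \<in> I" for j
    proof (cases "j \<in> Z")
      case True
      have "0 \<le> \<tau> j * c j p'" using c \<tau> N that by (intro mult_nonneg_nonneg) force+
      with True q1 show ?thesis by (force simp: val_def)
    next
      case False
      then show ?thesis using slack[of q1 j] that by (simp add: R_def)
    qed
    then have feas: "\<forall>j\<in>I. 0 \<le> val \<tau> p' j q1" by blast
    show "projection_licq I (\<lambda>j. A j p') (val \<tau> p') (z p')"
      unfolding projection_licq_def
    proof (intro conjI allI impI exI[of _ q1] feas)
      fix q assume "\<forall>q'. (\<forall>j\<in>I. 0 \<le> val \<tau> p' j q') \<longrightarrow> dist (z p') q \<le> dist (z p') q'"
      then have "dist (z p') q \<le> dist (z p') q1" using feas by blast
      then have "norm q \<le> R p'"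
        unfolding R_def dist_norm
        using norm_triangle_ineq4[of "z p'" "z p' - q"] norm_triangle_ineq4[of "z p'" q1] by simp
      then have sub: "{j \<in> I. val \<tau> p' j q = 0} \<subseteq> Z"
        using slack by force
      show "inj_on (\<lambda>j. A j p') {j \<in> I. val \<tau> p' j q = 0}"
        using ind sub by (blast intro: inj_on_subset)
      show "independent ((\<lambda>j. A j p') ` {j \<in> I. val \<tau> p' j q = 0})"
        by (rule independent_mono[OF conjunct2[OF ind]]) (use sub in blast)
    qed
  qed
  with N show ?thesis by blast
qed

lemma locally_uniform_threshold_compact:
  fixes P :: "real \<Rightarrow> 'p::topological_space \<Rightarrow> bool"
  assumes "compact C"
    and loc: "\<And>p. p \<in> C \<Longrightarrow> \<exists>N>0. \<forall>\<^sub>F p' in nhds p. p' \<in> C \<longrightarrow> P N p'"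
    and mono: "\<And>M N p. P M p \<Longrightarrow> M \<le> N \<Longrightarrow> P N p"
  shows "\<exists>N>0. \<forall>p\<in>C. P N p"
proof -
  obtain N where N: "\<forall>p\<in>C. 0 < N p \<and> (\<forall>\<^sub>F p' in nhds p. p' \<in> C \<longrightarrow> P (N p) p')"
    using bchoice[of C "\<lambda>p N. 0 < N \<and> (\<forall>\<^sub>F p' in nhds p. p' \<in> C \<longrightarrow> P N p')"] loc by blast
  then have "\<forall>p\<in>C. \<exists>U. open U \<and> p \<in> U \<and> (\<forall>p'\<in>U. p' \<in> C \<longrightarrow> P (N p) p')"
    by (simp add: eventually_nhds)
  from bchoice[OF this] obtain U where
    U: "\<forall>p\<in>C. open (U p) \<and> p \<in> U p \<and> (\<forall>p'\<in>U p. p' \<in> C \<longrightarrow> P (N p) p')" ..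
  obtain D where D: "D \<subseteq> C" "finite D" "C \<subseteq> (\<Union>p\<in>D. U p)"
  proof (rule compactE_image[OF \<open>compact C\<close>])
    show "open (U p)" if "p \<in> C" for p using U that by blast
    show "C \<subseteq> (\<Union>p\<in>C. U p)" using U by blast
  qed
  have Npos: "0 \<le> N p" if "p \<in> D" for p
    using N D that by (auto intro: less_imp_le)
  have "P (1 + sum N D) p'" if p': "p' \<in> C" for p'
  proof -
    obtain p where p: "p \<in> D" "p' \<in> U p" using D p' by blast
    have "N p \<le> sum N D"
      using D p by (intro member_le_sum Npos) auto
    moreover have "P (N p) p'" using U p D p' by blast
    ultimately show ?thesis using mono[of "N p" p' "1 + sum N D"] by simp
  qed
  moreover have "0 < 1 + sum N D"
    by (intro add_pos_nonneg sum_nonneg Npos) auto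
  ultimately show ?thesis by blast
qed

section \<open>The safe gradient flow program\<close>

lemma finite_constr: "finite (J :: constr set)"
proof (rule finite_subset)
  show "J \<subseteq> {C1, C2}" using constr.exhaust by blast
qed simp

definition sgf_target ::
  "(real ^ 'n \<Rightarrow> real) \<Rightarrow> (real ^ 'm \<Rightarrow> real ^ 'n) \<Rightarrow> real \<Rightarrow> (real ^ 'n) \<times> (real ^ 'm) \<Rightarrow> real ^ 'm" where
  "sgf_target \<Phi> w \<epsilon> p = - (\<epsilon> *\<^sub>R (transpose (jac w (snd p)) *v grad \<Phi> (fst p)))"

lemma sgf_cost_eq_dist: "sgf_cost \<Phi> w \<epsilon> p q = 1 / 2 * (dist (sgf_target \<Phi> w \<epsilon> p) q)\<^sup>2"
  by (simp add: sgf_cost_def sgf_target_def dist_norm norm_minus_commute[of _ q] case_prod_beta)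

lemma continuous_on_sgf_target:
  assumes \<Phi>: "Ck (Suc k) \<Phi>" and w: "Ck (Suc k') w"
  shows "continuous_on UNIV (sgf_target \<Phi> w \<epsilon>)"
proof (rule continuous_on_vec_componentI)
  fix i
  have "continuous_on UNIV (\<lambda>p. frechet_derivative w (at (snd p)) v)" for v
    by (rule continuous_on_compose2[OF continuous_on_frechet_derivative[OF w] continuous_on_snd])
      (auto intro: continuous_intros)
  moreover have "continuous_on UNIV (\<lambda>p. grad \<Phi> (fst p))"
    by (rule continuous_on_compose2[OF continuous_on_grad[OF \<Phi>] continuous_on_fst])
      (auto intro: continuous_intros)
  ultimately show "continuous_on UNIV (\<lambda>p. sgf_target \<Phi> w \<epsilon> p $ i)"
    by (simp add: sgf_target_def transpose_def matrix_vector_mult_def jac_def matrix_def)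
      (intro continuous_intros)
qed

lemma sgf_minimizer_is_projection:
  fixes \<Phi> w \<epsilon>
  assumes "\<exists>q. sgf_feasible f h b \<beta> r \<alpha> \<gamma> p q"
  defines "q0 \<equiv> sgf_minimizer f h b \<beta> r \<Phi> w \<epsilon> \<alpha> \<gamma> p"
  shows "sgf_feasible f h b \<beta> r \<alpha> \<gamma> p q0"
    and "sgf_feasible f h b \<beta> r \<alpha> \<gamma> p q \<Longrightarrow>
      dist (sgf_target \<Phi> w \<epsilon> p) q0 \<le> dist (sgf_target \<Phi> w \<epsilon> p) q"
proof -
  define z where "z = sgf_target \<Phi> w \<epsilon> p"
  define F where "F = {q. sgf_feasible f h b \<beta> r \<alpha> \<gamma> p q}"
  have aff: "\<exists>d. \<forall>q. constr_val f h b \<beta> r \<alpha> \<gamma> j p q = constr_grad f h b \<beta> r j p \<bullet> q + d" for j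
    by (cases j; cases p; force simp: algebra_simps)
  then obtain d where d: "\<And>j q. constr_val f h b \<beta> r \<alpha> \<gamma> j p q = constr_grad f h b \<beta> r j p \<bullet> q + d j"
    by metis
  have "0 \<le> x + d j \<longleftrightarrow> - d j \<le> x" for x j by linarith
  then have F: "F = (\<Inter>j. {q. constr_grad f h b \<beta> r j p \<bullet> q \<ge> - d j})"
    by (auto simp: F_def sgf_feasible_def d)
  have closed: "closed F" and convex: "convex F"
    by (simp_all add: F closed_halfspace_ge convex_halfspace_ge convex_INT closed_INT)
  have ne: "F \<noteq> {}"
    using assms(1) by (simp add: F_def)
  have arg: "is_arg_min (sgf_cost \<Phi> w \<epsilon> p) (sgf_feasible f h b \<beta> r \<alpha> \<gamma> p) q \<longleftrightarrow>
      q \<in> F \<and> (\<forall>q'\<in>F. dist z q \<le> dist z q')" for q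
    by (auto simp: is_arg_min_def sgf_cost_eq_dist z_def F_def not_less)
  note proj = closest_point_exists[OF closed ne, of z]
  have "q0 = closest_point F z"
    unfolding q0_def sgf_minimizer_def arg
  proof (rule the_equality)
    show "q = closest_point F z" if "q \<in> F \<and> (\<forall>q'\<in>F. dist z q \<le> dist z q')" for q
      using that by (intro closest_point_unique[OF convex closed]) auto
  qed (use proj in blast)
  with proj have *: "q0 \<in> F" "\<forall>q\<in>F. dist z q0 \<le> dist z q" by simp_all
  show "sgf_feasible f h b \<beta> r \<alpha> \<gamma> p q0" using * by (simp add: F_def)
  show "dist (sgf_target \<Phi> w \<epsilon> p) q0 \<le> dist (sgf_target \<Phi> w \<epsilon> p) q"
    if "sgf_feasible f h b \<beta> r \<alpha> \<gamma> p q"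
    using * that by (simp add: F_def z_def)
qed

text \<open>Independence of all active gradients survives perturbation and passes to subfamilies, so the rank
  of each subfamily stays equal to its cardinality.\<close>

lemma projection_licq_imp_CRCQ:
  assumes cont: "\<And>j. continuous_on UNIV (constr_grad f h b \<beta> r j)"
    and licq: "projection_licq UNIV (\<lambda>j. constr_grad f h b \<beta> r j p)
      (\<lambda>j. constr_val f h b \<beta> r \<alpha> \<gamma> j p) (sgf_target \<Phi> w \<epsilon> p)"
  shows "CRCQ f h b \<beta> r \<Phi> w \<epsilon> \<alpha> \<gamma> p"
proof -
  have feas: "\<exists>q. sgf_feasible f h b \<beta> r \<alpha> \<gamma> p q"
    using licq by (simp add: projection_licq_def sgf_feasible_def)
  define act where
    "act = {j. constr_val f h b \<beta> r \<alpha> \<gamma> j p (sgf_minimizer f h b \<beta> r \<Phi> w \<epsilon> \<alpha> \<gamma> p) = 0}"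
  have indep: "inj_on (\<lambda>j. constr_grad f h b \<beta> r j p) act"
    "independent ((\<lambda>j. constr_grad f h b \<beta> r j p) ` act)"
    using licq sgf_minimizer_is_projection[OF feas, where \<Phi> = \<Phi> and w = w and \<epsilon> = \<epsilon>]
    by (simp_all add: projection_licq_def sgf_feasible_def act_def)
  obtain U where U: "open U" "p \<in> U" and ind: "\<And>p'. p' \<in> U \<Longrightarrow>
      inj_on (\<lambda>j. constr_grad f h b \<beta> r j p') act \<and>
      independent ((\<lambda>j. constr_grad f h b \<beta> r j p') ` act)"
    using eventually_independent_family[OF finite_constr cont indep] unfolding eventually_nhds by blast
  have "dim ((\<lambda>j. constr_grad f h b \<beta> r j p') ` J) = card J" if "p' \<in> U" "J \<subseteq> act" for p' J
  proof -
    have "independent ((\<lambda>j. constr_grad f h b \<beta> r j p') ` J)"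
      using ind[OF that(1)] that(2) by (meson image_mono independent_mono)
    moreover have "inj_on (\<lambda>j. constr_grad f h b \<beta> r j p') J"
      using ind[OF that(1)] that(2) by (meson inj_on_subset)
    ultimately show ?thesis by (simp add: dim_eq_card_independent card_image)
  qed
  with U feas show ?thesis unfolding CRCQ_def act_def[symmetric] by blast
qed

theorem mainTheorem3:
  fixes f :: "(real ^ 'n) \<times> (real ^ 'm) \<Rightarrow> real ^ 'n"
    and w :: "real ^ 'm \<Rightarrow> real ^ 'n"
    and \<Phi> h :: "real ^ 'n \<Rightarrow> real"
    and b :: "real ^ 'm \<Rightarrow> real"
    and \<beta> \<epsilon> :: real
    and r :: nat
    and C :: "((real ^ 'n) \<times> (real ^ 'm)) set"
  assumes w_def: "steady_state_map f w"
    and \<beta>_pos: "\<beta> > 0"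
    and r_pos: "r \<ge> 1"
    and f_smooth: "Ck (r + 1) f"
    and h_smooth: "Ck (r + 2) h"
    and S_r_nonempty: "Sset f h b \<beta> r \<noteq> {}"
    and grad_u_h_r: "\<forall>p \<in> Sset f h b \<beta> r. hseq f h \<beta> r p = 0 \<longrightarrow> grad_u (hseq f h \<beta> r) p \<noteq> 0"
    and grad_u_h_i: "\<forall>p \<in> Sset f h b \<beta> r. \<forall>i<r. grad_u (hseq f h \<beta> i) p = 0"
    and b_smooth: "Ck 2 b"
    and S_nonempty: "Sset f h b \<beta> 0 \<noteq> {}"
    and grad_b: "\<forall>(x, u) \<in> Sset f h b \<beta> 0. b u = 0 \<longrightarrow> grad b u \<noteq> 0"
    and \<Phi>_smooth: "Ck 2 \<Phi>"
    and w_smooth: "Ck 2 w"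
    and \<epsilon>_pos: "\<epsilon> > 0"
    and C_subset: "C \<subseteq> Sset f h b \<beta> r"
    and C_compact: "compact C"
    and lin_indep: "\<forall>(x, u) \<in> C. b u = 0 \<and> hseq f h \<beta> r (x, u) = 0 \<longrightarrow>
          grad b u \<noteq> grad_u (hseq f h \<beta> r) (x, u) \<and>
          independent {grad b u, grad_u (hseq f h \<beta> r) (x, u)}"
  shows "\<exists>\<alpha>0>0. \<exists>\<gamma>0>0. \<forall>\<alpha>>\<alpha>0. \<forall>\<gamma>>\<gamma>0. \<forall>p \<in> C. CRCQ f h b \<beta> r \<Phi> w \<epsilon> \<alpha> \<gamma> p"
proof -
  let ?H = "hseq f h \<beta> r"
  define A where "A = constr_grad f h b \<beta> r"
  define l where "l j p = (case j of C1 \<Rightarrow> 0 | C2 \<Rightarrow> grad_x ?H p \<bullet> f p)" for j p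
  define c where "c j p = (case j of C1 \<Rightarrow> b (snd p) | C2 \<Rightarrow> ?H p)" for j p
  define z where "z = sgf_target \<Phi> w \<epsilon>"
  have A_simps: "A C1 = (\<lambda>p. grad b (snd p))" "A C2 = grad_u ?H"
    by (auto simp: A_def fun_eq_iff)
  have val: "constr_val f h b \<beta> r \<alpha> \<gamma> j p q = A j p \<bullet> q + l j p + (case j of C1 \<Rightarrow> \<alpha> | C2 \<Rightarrow> \<gamma>) * c j p"
    for \<alpha> \<gamma> j p q
    by (cases j; cases p) (simp_all add: A_def l_def c_def)
  have smooth: "Ck (Suc (Suc 0)) b" "Ck (Suc (Suc 0)) \<Phi>" "Ck (Suc (Suc 0)) w" "Ck (Suc (Suc 0)) ?H"
    using b_smooth \<Phi>_smooth w_smooth Ck_hseq[OF f_smooth h_smooth order_refl]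
    by (simp_all only: numeral_2_eq_2 add_diff_cancel_left')
  have contA: "continuous_on UNIV (A j)" for j
    using continuous_on_grad_u[OF smooth(4)]
      continuous_on_compose2[OF continuous_on_grad[OF smooth(1)] continuous_on_snd[OF continuous_on_id]]
    by (cases j) (simp_all add: A_simps)
  have contl: "continuous_on UNIV (l j)" for j
    using continuous_on_inner[OF continuous_on_grad_x[OF smooth(4)] Ck_imp_continuous_on[OF f_smooth]]
    by (cases j) (simp_all add: l_def[abs_def])
  have contc: "continuous_on UNIV (c j)" for j
    using Ck_imp_continuous_on[OF smooth(4)]
      continuous_on_compose2[OF Ck_imp_continuous_on[OF smooth(1)] continuous_on_snd[OF continuous_on_id]]
    by (cases j) (simp_all add: c_def[abs_def])
  have contz: "continuous_on UNIV z"
    unfolding z_def by (rule continuous_on_sgf_target[OF smooth(2,3)])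
  have nonneg: "0 \<le> c j p" if "p \<in> C" for j p
    using C_subset that by (cases j) (auto simp: c_def Sset_def)
  \<comment> \<open>Membership of \<open>(x, u)\<close> in the safe set constrains \<open>x\<close> and \<open>u\<close> separately, so one state \<open>x0\<close>
    with \<open>h x0 \<ge> 0\<close> transfers the regularity of \<open>b\<close> to every \<open>u\<close>.\<close>
  obtain x0 where "h x0 \<ge> 0" using S_nonempty by (auto simp: Sset_def)
  then have gb: "grad b u \<noteq> 0" if "b u = 0" for u
    using grad_b that by (force simp: Sset_def)
  have indep: "inj_on (\<lambda>j. A j p) {j \<in> UNIV. c j p = 0} \<and>
      independent ((\<lambda>j. A j p) ` {j \<in> UNIV. c j p = 0})" if p: "p \<in> C" for p
  proof -
    obtain x u where xu: "p = (x, u)" by (cases p)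
    have Z: "{j \<in> UNIV. c j p = 0} = (if b u = 0 then {C1} else {}) \<union> (if ?H p = 0 then {C2} else {})"
    proof (rule set_eqI)
      fix j show "j \<in> {j \<in> UNIV. c j p = 0} \<longleftrightarrow>
        j \<in> (if b u = 0 then {C1} else {}) \<union> (if ?H p = 0 then {C2} else {})"
        by (cases j) (auto simp: c_def xu)
    qed
    have "?H p = 0 \<Longrightarrow> grad_u ?H p \<noteq> 0" using grad_u_h_r C_subset p by blast
    with gb[of u] lin_indep p show ?thesis
      unfolding Z by (auto simp: A_simps xu insert_commute independent_empty)
  qed
  define P where "P N p \<longleftrightarrow> (\<forall>\<alpha>>N. \<forall>\<gamma>>N. CRCQ f h b \<beta> r \<Phi> w \<epsilon> \<alpha> \<gamma> p)" for N p
  have "\<exists>N>0. \<forall>p\<in>C. P N p"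
  proof (rule locally_uniform_threshold_compact[OF C_compact])
    fix p assume p: "p \<in> C"
    from licq_projection_locally[where l = l, OF finite_constr contA contl contc contz nonneg[OF p]
        conjunct1[OF indep[OF p]] conjunct2[OF indep[OF p]]]
    obtain N where "0 < N" and ev: "\<forall>\<^sub>F p' in nhds p. (\<forall>j. 0 \<le> c j p') \<longrightarrow> (\<forall>\<tau>. (\<forall>j. N < \<tau> j) \<longrightarrow>
      projection_licq UNIV (\<lambda>j. A j p') (\<lambda>j q. A j p' \<bullet> q + l j p' + \<tau> j * c j p') (z p'))"
      by auto
    have "P N p'"
      if licq: "(\<forall>j. 0 \<le> c j p') \<longrightarrow> (\<forall>\<tau>. (\<forall>j. N < \<tau> j) \<longrightarrow>
        projection_licq UNIV (\<lambda>j. A j p') (\<lambda>j q. A j p' \<bullet> q + l j p' + \<tau> j * c j p') (z p'))"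
        and p': "p' \<in> C" for p'
      unfolding P_def
    proof (intro allI impI)
      fix \<alpha> \<gamma> assume "N < \<alpha>" "N < \<gamma>"
      then have "N < (case j of C1 \<Rightarrow> \<alpha> | C2 \<Rightarrow> \<gamma>)" for j by (cases j) auto
      with licq nonneg[OF p'] have "projection_licq UNIV (\<lambda>j. A j p')
          (\<lambda>j. constr_val f h b \<beta> r \<alpha> \<gamma> j p') (z p')"
        by (simp add: val[abs_def])
      then show "CRCQ f h b \<beta> r \<Phi> w \<epsilon> \<alpha> \<gamma> p'"
        using projection_licq_imp_CRCQ[OF contA[unfolded A_def]] by (simp add: A_def z_def)
    qed
    then have "\<forall>\<^sub>F p' in nhds p. p' \<in> C \<longrightarrow> P N p'"
      by (intro eventually_mono[OF ev] impI)
    with \<open>0 < N\<close> show "\<exists>N>0. \<forall>\<^sub>F p' in nhds p. p' \<in> C \<longrightarrow> P N p'" by blast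
  qed (auto simp: P_def)
  then obtain N where "0 < N" "\<forall>p\<in>C. P N p" by blast
  then show ?thesis unfolding P_def by blast
qed

end
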